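(* Each rule of the focused display calculus fD.LG is sound under any interpretation in a fully polarized LG-algebra: for every fully polarized LG-algebra $\mathbb A$, every interpretation $(\cdot)^{\mathbb A}$ in $\mathbb A$ and every instance of a rule of fD.LG, if the interpretations of all premises hold in $\mathbb A$, then the interpretation of the conclusion holds in $\mathbb A$.
   Context: **Fully polarized LG-algebras.** A weakening relation between posets $\mathcal A,\mathcal B$ is $R\subseteq\mathcal A\times\mathcal B$ such that $a'\le a$, $a\,R\,b$, $b\le b'$ imply $a'\,R\,b'$. A fully polarized LG-algebra consists of four posets $\mathbb P,\dot{\mathbb P},\mathbb N,\dot{\mathbb N}$ with: (1) adjunctions $\uparrow\dashv\Downarrow$ ($\uparrow:\mathbb P\to\dot{\mathbb N}$, $\Downarrow:\dot{\mathbb N}\to\mathbb P$) and $\Uparrow\dashv\downarrow$ ($\Uparrow:\dot{\mathbb P}\to\mathbb N$, $\downarrow:\mathbb N\to\dot{\mathbb P}$); let $\preceq_1\subseteq\mathbb P\times\dot{\mathbb N}$ be given by $a\preceq_1 b$ iff $\uparrow a\le b$ (iff $a\le\Downarrow b$) and $\preceq_2\subseteq\dot{\mathbb P}\times\mathbb N$ by $a\preceq_2b$ iff $\Uparrow a\le b$ (iff $a\le\downarrow b$); (2) weakening relations $\preceq_+\subseteq\mathbb P\times\dot{\mathbb P}$, $\preceq\ \subseteq\mathbb P\times\mathbb N$, $\preceq_-\subseteq\dot{\mathbb N}\times\mathbb N$ such that for $a\in\mathbb P,b\in\mathbb N$: $\uparrow a\preceq_-b$ iff $a\preceq b$ iff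 $a\preceq_+\downarrow b$. Put $\mathring{\mathbb P}=\mathbb P\sqcup\dot{\mathbb P}$ with order $\le_+\,=\,\le_{\mathbb P}\sqcup\preceq_+\sqcup\le_{\dot{\mathbb P}}$, $\mathring{\mathbb N}=\mathbb N\sqcup\dot{\mathbb N}$ with order $\le_-\,=\,\le_{\mathbb N}\sqcup\preceq_-\sqcup\le_{\dot{\mathbb N}}$, and $\preceq_0\,=\,\preceq_1\sqcup\preceq\sqcup\preceq_2\ \subseteq\mathring{\mathbb P}\times\mathring{\mathbb N}$; (3) operations ($\partial$ = order dual) $\otimes:\mathring{\mathbb P}\times\mathring{\mathbb P}\to\mathbb P$, $\oslash:\mathring{\mathbb P}\times\mathring{\mathbb N}^\partial\to\mathbb P$, $\ominus:\mathring{\mathbb N}^\partial\times\mathring{\mathbb P}\to\mathbb P$, $\oplus:\mathring{\mathbb N}\times\mathring{\mathbb N}\to\mathbb N$, $\backslash:\mathring{\mathbb P}^\partial\times\mathring{\mathbb N}\to\mathbb N$, $/:\mathring{\mathbb N}\times\mathring{\mathbb P}^\partial\to\mathbb N$ with (for $P,Q,R\in\mathring{\mathbb P}$, $L,M,N\in\mathring{\mathbb N}$) $Q\preceq_0P\backslash N$ iff $P\otimes Q\preceq_0N$ iff $P\preceq_0N/Q$; and $P\oslash N\preceq_0M$ iff $P\preceq_0M\oplus N$ iff $M\ominus P\preceq_0N$; (4) operations $\otimes_\ell:\mathring{\mathbb N}\times\mathring{\mathbb P}\to\dot{\mathbb N}$, $\oslash_\ell:\mathring{\mathbb N}\times\mathring{\mathbb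 N}^\partial\to\dot{\mathbb N}$, $\ominus_\ell:\mathring{\mathbb P}^\partial\times\mathring{\mathbb P}\to\dot{\mathbb N}$, $\oplus_\ell:\mathring{\mathbb P}\times\mathring{\mathbb N}\to\dot{\mathbb P}$, $\backslash_\ell:\mathring{\mathbb N}^\partial\times\mathring{\mathbb N}\to\dot{\mathbb P}$, $/_\ell:\mathring{\mathbb P}\times\mathring{\mathbb P}^\partial\to\dot{\mathbb P}$, $\otimes_r:\mathring{\mathbb P}\times\mathring{\mathbb N}\to\dot{\mathbb N}$, $\oslash_r:\mathring{\mathbb P}\times\mathring{\mathbb P}^\partial\to\dot{\mathbb N}$, $\ominus_r:\mathring{\mathbb N}^\partial\times\mathring{\mathbb N}\to\dot{\mathbb N}$, $\oplus_r:\mathring{\mathbb N}\times\mathring{\mathbb P}\to\dot{\mathbb P}$, $\backslash_r:\mathring{\mathbb P}^\partial\times\mathring{\mathbb P}\to\dot{\mathbb P}$, $/_r:\mathring{\mathbb N}\times\mathring{\mathbb N}^\partial\to\dot{\mathbb P}$ with: $Q\le_+P\backslash_rR$ iff $P\otimes Q\le_+R$ iff $P\le_+R/_\ell Q$; $L\oslash_\ell N\le_-M$ iff $L\le_-M\oplus N$ iff $M\ominus_rL\le_-N$; $Q\le_+L\backslash_\ell N$ iff $L\otimes_\ell Q\le_-N$ iff $L\le_-N/Q$; $P\oslash_rR\le_-M$ iff $P\le_+M\oplus_rR$ iff $M\ominus P\le_+R$; $L\le_-P\backslash N$ iff $P\otimes_rL\le_-N$ iff $P\le_+N/_rL$; $P\oslash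 N\le_+R$ iff $P\le_+R\oplus_\ell N$ iff $R\ominus_\ell P\le_-N$. **The calculus fD.LG.** Fix two disjoint countably infinite sets of positive atoms $p$ and negative atoms $n$. Formulas of four sorts: pure positive $P ::= p\mid \mathring P\otimes\mathring P\mid \mathring P\oslash\mathring N\mid \mathring N\ominus\mathring P$; pure negative $N ::= n\mid \mathring N\oplus\mathring N\mid \mathring P\backslash\mathring N\mid \mathring N/\mathring P$; shifted positive $\dot P ::= \,\downarrow N$; shifted negative $\dot N ::= \,\uparrow P$. A ring means "pure or shifted": $\mathring P$ (general positive) is $P$ or $\dot P$, $\mathring N$ (general negative) is $N$ or $\dot N$; same convention for structures and for $Q,M,\dots$ Structures (structural connectives carry $\hat{\ }$ or $\check{\ }$): pure positive $X ::= P\mid \check{\Downarrow}\dot\Delta\mid \mathring X\hat\otimes\mathring X\mid\mathring X\hat\oslash\mathring\Delta\mid\mathring\Delta\hat\ominus\mathring X$; pure negative $\Delta ::= N\mid\hat{\Uparrow}\dot X\mid\mathring\Delta\check\oplus\mathring\Delta\mid\mathring X\check\backslash\mathring\Delta\mid\mathring\Delta\check/\mathring X$; shifted positive $\dot X ::= \dot P\mid\check\downarrow\Delta\mid\mathring X\check\oplus_\ell\mathring\Delta\mid\mathring\Delta\check\oplus_r\mathring X\mid\mathring\Delta\check\backslash_\ell\mathring\Delta\mid\mathring X\check\backslash_r\mathring X\mid\mathring X\check/_\ell\mathring X\mid\mathring\Delta\check/_r\mathring\Delta$; shifted negative $\dot\Delta ::= \dot N\mid\hat\uparrow X\mid\mathring\Delta\hat\otimes_\ell\mathring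 X\mid\mathring X\hat\otimes_r\mathring\Delta\mid\mathring\Delta\hat\oslash_\ell\mathring\Delta\mid\mathring X\hat\oslash_r\mathring X\mid\mathring X\hat\ominus_\ell\mathring X\mid\mathring\Delta\hat\ominus_r\mathring\Delta$. Sequents: positive $\mathring X\vdash_+\mathring Y$, negative $\mathring\Gamma\vdash_-\mathring\Delta$, neutral $\mathring X\vdash_0\mathring\Delta$ (the exact turnstile is determined by the sorts of both sides). Rules ($\Rightarrow$: premises to conclusion; $\Leftrightarrow$: both directions). *Axioms:* $p\vdash_+p$; $n\vdash_-n$. *Cuts:* $\mathring X\vdash_+\mathring P,\ \mathring P\vdash_+\mathring Y\Rightarrow\mathring X\vdash_+\mathring Y$; $\mathring\Gamma\vdash_-\mathring N,\ \mathring N\vdash_-\mathring\Delta\Rightarrow\mathring\Gamma\vdash_-\mathring\Delta$; $\mathring X\vdash_+\mathring P,\ \mathring P\vdash_0\mathring\Delta\Rightarrow\mathring X\vdash_0\mathring\Delta$; $\mathring X\vdash_0\mathring N,\ \mathring N\vdash_-\mathring\Delta\Rightarrow\mathring X\vdash_0\mathring\Delta$. *Translation rules:* $\mathring P\hat\otimes\mathring Q\vdash_0\mathring\Delta\Rightarrow\mathring P\otimes\mathring Q\vdash_0\mathring\Delta$; $\mathring P\hat\oslash\mathring N\vdash_0\mathring\Delta\Rightarrow\mathring P\oslash\mathring N\vdash_0\mathring\Delta$; $\mathring N\hat\ominus\mathring P\vdash_0\mathring\Delta\Rightarrow\mathring N\ominus\mathring P\vdash_0\mathring\Delta$; $\mathring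 X\vdash_0\mathring N\check\oplus\mathring M\Rightarrow\mathring X\vdash_0\mathring N\oplus\mathring M$; $\mathring X\vdash_0\mathring P\check\backslash\mathring N\Rightarrow\mathring X\vdash_0\mathring P\backslash\mathring N$; $\mathring X\vdash_0\mathring N\check/\mathring P\Rightarrow\mathring X\vdash_0\mathring N/\mathring P$; $\mathring X\vdash_+\check\downarrow N\Rightarrow\mathring X\vdash_+\downarrow N$; $\hat\uparrow P\vdash_-\mathring\Delta\Rightarrow\ \uparrow P\vdash_-\mathring\Delta$. *Tonicity rules:* $\mathring X\vdash_+\mathring P,\ \mathring Y\vdash_+\mathring Q\Rightarrow\mathring X\hat\otimes\mathring Y\vdash_+\mathring P\otimes\mathring Q$; $\mathring N\vdash_-\mathring\Gamma,\ \mathring M\vdash_-\mathring\Delta\Rightarrow\mathring N\oplus\mathring M\vdash_-\mathring\Gamma\check\oplus\mathring\Delta$; from $\mathring X\vdash_+\mathring P$ and $\mathring N\vdash_-\mathring\Delta$ infer each of $\mathring X\hat\oslash\mathring\Delta\vdash_+\mathring P\oslash\mathring N$, $\ \mathring\Delta\hat\ominus\mathring X\vdash_+\mathring N\ominus\mathring P$, $\ \mathring P\backslash\mathring N\vdash_-\mathring X\check\backslash\mathring\Delta$, $\ \mathring N/\mathring P\vdash_-\mathring\Delta\check/\mathring X$; $N\vdash_-\Delta\Rightarrow\ \downarrow N\vdash_+\check\downarrow\Delta$; $X\vdash_+P\Rightarrow\hat\uparrow X\vdash_-\uparrow P$. *Display postulates:* $\mathring Y\vdash_0\mathring X\check\backslash\mathring\Delta\Leftrightarrow\mathring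 X\hat\otimes\mathring Y\vdash_0\mathring\Delta\Leftrightarrow\mathring X\vdash_0\mathring\Delta\check/\mathring Y$; $\mathring X\hat\oslash\mathring\Delta\vdash_0\mathring\Gamma\Leftrightarrow\mathring X\vdash_0\mathring\Gamma\check\oplus\mathring\Delta\Leftrightarrow\mathring\Gamma\hat\ominus\mathring X\vdash_0\mathring\Delta$; $\mathring Y\vdash_+\mathring X\check\backslash_r\mathring Z\Leftrightarrow\mathring X\hat\otimes\mathring Y\vdash_+\mathring Z\Leftrightarrow\mathring X\vdash_+\mathring Z\check/_\ell\mathring Y$; $\mathring\Sigma\hat\oslash_\ell\mathring\Delta\vdash_-\mathring\Gamma\Leftrightarrow\mathring\Sigma\vdash_-\mathring\Gamma\check\oplus\mathring\Delta\Leftrightarrow\mathring\Gamma\hat\ominus_r\mathring\Sigma\vdash_-\mathring\Delta$; $\mathring\Gamma\hat\ominus\mathring X\vdash_+\mathring Y\Leftrightarrow\mathring X\vdash_+\mathring\Gamma\check\oplus_r\mathring Y\Leftrightarrow\mathring X\hat\oslash_r\mathring Y\vdash_-\mathring\Gamma$; $\mathring X\hat\oslash\mathring\Delta\vdash_+\mathring Y\Leftrightarrow\mathring X\vdash_+\mathring Y\check\oplus_\ell\mathring\Delta\Leftrightarrow\mathring Y\hat\ominus_\ell\mathring X\vdash_-\mathring\Delta$; $\mathring\Gamma\vdash_-\mathring X\check\backslash\mathring\Delta\Leftrightarrow\mathring X\hat\otimes_r\mathring\Gamma\vdash_-\mathring\Delta\Leftrightarrow\mathring X\vdash_+\mathring\Delta\check/_r\mathring\Gamma$;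 $\mathring Y\vdash_+\mathring\Gamma\check\backslash_\ell\mathring\Delta\Leftrightarrow\mathring\Gamma\hat\otimes_\ell\mathring Y\vdash_-\mathring\Delta\Leftrightarrow\mathring\Gamma\vdash_-\mathring\Delta\check/\mathring Y$; $\hat\uparrow X\vdash_-\dot\Delta\Leftrightarrow X\vdash_+\check\Downarrow\dot\Delta$; $\hat\uparrow X\vdash_-\Delta\Leftrightarrow X\vdash_+\check\downarrow\Delta$; $\dot X\vdash_+\check\downarrow\Delta\Leftrightarrow\hat\Uparrow\dot X\vdash_-\Delta$. *Structural rules:* $\mathring X\vdash_0\Delta\Leftrightarrow\mathring X\vdash_+\check\downarrow\Delta$; $X\vdash_0\mathring\Delta\Leftrightarrow\hat\uparrow X\vdash_-\mathring\Delta$. **Interpretation.** An interpretation in $\mathbb A$ assigns to each positive atom an element of $\mathbb P$ and to each negative atom an element of $\mathbb N$, and is extended homomorphically to formulas and structures (a structural connective and its operational counterpart are interpreted by the operation of the same name). The turnstiles $\vdash_+,\vdash_-,\vdash_0$ are interpreted by $\le_+,\le_-,\preceq_0$ respectively. *)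

theory Defs
  imports Main
begin

section \<open>Fully polarized LG-algebras\<close>

text \<open>
  The four posets are the types \<open>'p\<close> (pure positive), \<open>'dp\<close> (shifted positive), \<open>'n\<close> (pure
  negative) and \<open>'dn\<close> (shifted negative), all of class \<^class>\<open>order\<close>.  The general carriers are the
  disjoint unions \<open>'p + 'dp\<close> and \<open>'n + 'dn\<close>; throughout, \<^const>\<open>Inl\<close> marks the pure summand and
  \<^const>\<open>Inr\<close> the shifted one.  The operations named \<open>under\<close> and \<open>over\<close> are the residuals written
  with a backslash and with a slash, and the suffixes \<open>l\<close> and \<open>r\<close> are the subscripts of the
  heterogeneous operations.
\<close>

record ('p, 'dp, 'n, 'dn) LG_ops =
  up :: "'p \<Rightarrow> 'dn"        \<comment> \<open>single up arrow\<close>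
  ddown :: "'dn \<Rightarrow> 'p"     \<comment> \<open>double down arrow\<close>
  uup :: "'dp \<Rightarrow> 'n"       \<comment> \<open>double up arrow\<close>
  down :: "'n \<Rightarrow> 'dp"      \<comment> \<open>single down arrow\<close>
  wkp :: "'p \<Rightarrow> 'dp \<Rightarrow> bool"
  wk :: "'p \<Rightarrow> 'n \<Rightarrow> bool"
  wkm :: "'dn \<Rightarrow> 'n \<Rightarrow> bool"
  otimes :: "'p + 'dp \<Rightarrow> 'p + 'dp \<Rightarrow> 'p"
  oslash :: "'p + 'dp \<Rightarrow> 'n + 'dn \<Rightarrow> 'p"
  ominus :: "'n + 'dn \<Rightarrow> 'p + 'dp \<Rightarrow> 'p"
  oplus :: "'n + 'dn \<Rightarrow> 'n + 'dn \<Rightarrow> 'n"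
  under :: "'p + 'dp \<Rightarrow> 'n + 'dn \<Rightarrow> 'n"
  over :: "'n + 'dn \<Rightarrow> 'p + 'dp \<Rightarrow> 'n"
  otimes_l :: "'n + 'dn \<Rightarrow> 'p + 'dp \<Rightarrow> 'dn"
  oslash_l :: "'n + 'dn \<Rightarrow> 'n + 'dn \<Rightarrow> 'dn"
  ominus_l :: "'p + 'dp \<Rightarrow> 'p + 'dp \<Rightarrow> 'dn"
  oplus_l :: "'p + 'dp \<Rightarrow> 'n + 'dn \<Rightarrow> 'dp"
  under_l :: "'n + 'dn \<Rightarrow> 'n + 'dn \<Rightarrow> 'dp"
  over_l :: "'p + 'dp \<Rightarrow> 'p + 'dp \<Rightarrow> 'dp"
  otimes_r :: "'p + 'dp \<Rightarrow> 'n + 'dn \<Rightarrow> 'dn"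
  oslash_r :: "'p + 'dp \<Rightarrow> 'p + 'dp \<Rightarrow> 'dn"
  ominus_r :: "'n + 'dn \<Rightarrow> 'n + 'dn \<Rightarrow> 'dn"
  oplus_r :: "'n + 'dn \<Rightarrow> 'p + 'dp \<Rightarrow> 'dp"
  under_r :: "'p + 'dp \<Rightarrow> 'p + 'dp \<Rightarrow> 'dp"
  over_r :: "'n + 'dn \<Rightarrow> 'n + 'dn \<Rightarrow> 'dp"

definition adjunction :: "('a::order \<Rightarrow> 'b::order) \<Rightarrow> ('b \<Rightarrow> 'a) \<Rightarrow> bool" where
  "adjunction f g \<longleftrightarrow> (\<forall>a b. f a \<le> b \<longleftrightarrow> a \<le> g b)"

definition weakening :: "('a::order \<Rightarrow> 'b::order \<Rightarrow> bool) \<Rightarrow> bool" where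
  "weakening R \<longleftrightarrow> (\<forall>a' a b b'. a' \<le> a \<longrightarrow> R a b \<longrightarrow> b \<le> b' \<longrightarrow> R a' b')"

fun le_pos :: "('p::order, 'dp::order, 'n::order, 'dn::order) LG_ops \<Rightarrow> 'p + 'dp \<Rightarrow> 'p + 'dp \<Rightarrow> bool" where
  "le_pos A (Inl a) (Inl b) \<longleftrightarrow> a \<le> b"
| "le_pos A (Inl a) (Inr b) \<longleftrightarrow> wkp A a b"
| "le_pos A (Inr a) (Inr b) \<longleftrightarrow> a \<le> b"
| "le_pos A (Inr a) (Inl b) \<longleftrightarrow> False"

fun le_neg :: "('p::order, 'dp::order, 'n::order, 'dn::order) LG_ops \<Rightarrow> 'n + 'dn \<Rightarrow> 'n + 'dn \<Rightarrow> bool" where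
  "le_neg A (Inl a) (Inl b) \<longleftrightarrow> a \<le> b"
| "le_neg A (Inr a) (Inl b) \<longleftrightarrow> wkm A a b"
| "le_neg A (Inr a) (Inr b) \<longleftrightarrow> a \<le> b"
| "le_neg A (Inl a) (Inr b) \<longleftrightarrow> False"

fun prec0 :: "('p::order, 'dp::order, 'n::order, 'dn::order) LG_ops \<Rightarrow> 'p + 'dp \<Rightarrow> 'n + 'dn \<Rightarrow> bool" where
  "prec0 A (Inl a) (Inr b) \<longleftrightarrow> up A a \<le> b"
| "prec0 A (Inl a) (Inl b) \<longleftrightarrow> wk A a b"
| "prec0 A (Inr a) (Inl b) \<longleftrightarrow> uup A a \<le> b"
| "prec0 A (Inr a) (Inr b) \<longleftrightarrow> False"

text \<open>
  The tonicity of the operations (the order duals in their types) is not assumed separately: it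
  follows from the residuation laws, see the lemmas below.
\<close>

locale fully_polarized_LG_algebra =
  fixes A :: "('p::order, 'dp::order, 'n::order, 'dn::order) LG_ops"
  assumes adj_up: "adjunction (up A) (ddown A)"
    and adj_uup: "adjunction (uup A) (down A)"
    and weakening_wkp: "weakening (wkp A)"
    and weakening_wk: "weakening (wk A)"
    and weakening_wkm: "weakening (wkm A)"
    and wkm_up: "wkm A (up A a) b \<longleftrightarrow> wk A a b"
    and wkp_down: "wk A a b \<longleftrightarrow> wkp A a (down A b)"
    and res0_under: "prec0 A Q (Inl (under A P N)) \<longleftrightarrow> prec0 A (Inl (otimes A P Q)) N"
    and res0_over: "prec0 A (Inl (otimes A P Q)) N \<longleftrightarrow> prec0 A P (Inl (over A N Q))"
    and res0_oslash: "prec0 A (Inl (oslash A P N)) M \<longleftrightarrow> prec0 A P (Inl (oplus A M N))"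
    and res0_ominus: "prec0 A P (Inl (oplus A M N)) \<longleftrightarrow> prec0 A (Inl (ominus A M P)) N"
    and res_under_r: "le_pos A Q (Inr (under_r A P R)) \<longleftrightarrow> le_pos A (Inl (otimes A P Q)) R"
    and res_over_l: "le_pos A (Inl (otimes A P Q)) R \<longleftrightarrow> le_pos A P (Inr (over_l A R Q))"
    and res_oslash_l: "le_neg A (Inr (oslash_l A L N)) M \<longleftrightarrow> le_neg A L (Inl (oplus A M N))"
    and res_ominus_r: "le_neg A L (Inl (oplus A M N)) \<longleftrightarrow> le_neg A (Inr (ominus_r A M L)) N"
    and res_under_l: "le_pos A Q (Inr (under_l A L N)) \<longleftrightarrow> le_neg A (Inr (otimes_l A L Q)) N"
    and res_over: "le_neg A (Inr (otimes_l A L Q)) N \<longleftrightarrow> le_neg A L (Inl (over A N Q))"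
    and res_oslash_r: "le_neg A (Inr (oslash_r A P R)) M \<longleftrightarrow> le_pos A P (Inr (oplus_r A M R))"
    and res_ominus: "le_pos A P (Inr (oplus_r A M R)) \<longleftrightarrow> le_pos A (Inl (ominus A M P)) R"
    and res_under: "le_neg A L (Inl (under A P N)) \<longleftrightarrow> le_neg A (Inr (otimes_r A P L)) N"
    and res_over_r: "le_neg A (Inr (otimes_r A P L)) N \<longleftrightarrow> le_pos A P (Inr (over_r A N L))"
    and res_oslash: "le_pos A (Inl (oslash A P N)) R \<longleftrightarrow> le_pos A P (Inr (oplus_l A R N))"
    and res_ominus_l: "le_pos A P (Inr (oplus_l A R N)) \<longleftrightarrow> le_neg A (Inr (ominus_l A R P)) N"
begin

lemma le_pos_refl: "le_pos A x x"
  by (cases x) auto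

lemma le_pos_trans: "le_pos A x y \<Longrightarrow> le_pos A y z \<Longrightarrow> le_pos A x z"
proof -
  have "wkp A a' b'" if "a' \<le> a" "wkp A a b" "b \<le> b'" for a' a b b'
    using weakening_wkp that unfolding weakening_def by blast
  then show "le_pos A x y \<Longrightarrow> le_pos A y z \<Longrightarrow> le_pos A x z"
    by (cases x; cases y; cases z) (auto intro: order_trans)
qed

lemma le_pos_antisym: "le_pos A x y \<Longrightarrow> le_pos A y x \<Longrightarrow> x = y"
  by (cases x; cases y) auto

lemma le_neg_refl: "le_neg A x x"
  by (cases x) auto

lemma le_neg_trans: "le_neg A x y \<Longrightarrow> le_neg A y z \<Longrightarrow> le_neg A x z"
proof -
  have "wkm A a' b'" if "a' \<le> a" "wkm A a b" "b \<le> b'" for a' a b b'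
    using weakening_wkm that unfolding weakening_def by blast
  then show "le_neg A x y \<Longrightarrow> le_neg A y z \<Longrightarrow> le_neg A x z"
    by (cases x; cases y; cases z) (auto intro: order_trans)
qed

lemma le_neg_antisym: "le_neg A x y \<Longrightarrow> le_neg A y x \<Longrightarrow> x = y"
  by (cases x; cases y) auto

lemma le_pos_Inl: "a \<le> b \<longleftrightarrow> le_pos A (Inl a) (Inl b)" by simp
lemma le_pos_Inr: "a \<le> b \<longleftrightarrow> le_pos A (Inr a) (Inr b)" by simp
lemma le_neg_Inl: "a \<le> b \<longleftrightarrow> le_neg A (Inl a) (Inl b)" by simp
lemma le_neg_Inr: "a \<le> b \<longleftrightarrow> le_neg A (Inr a) (Inr b)" by simp

lemma otimes_tonic:
  assumes "le_pos A P P'" "le_pos A Q Q'"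
  shows "otimes A P Q \<le> otimes A P' Q'"
  using le_pos_refl[of "Inl (otimes A P' Q')"] le_pos_trans[OF assms(1)] le_pos_trans[OF assms(2)]
    le_pos_trans[OF _ assms(1)] le_pos_trans[OF _ assms(2)]
  unfolding le_pos_Inl by (metis res_under_r res_over_l)

lemma oslash_tonic:
  assumes "le_pos A P P'" "le_neg A N' N"
  shows "oslash A P N \<le> oslash A P' N'"
  using le_pos_refl[of "Inl (oslash A P' N')"] le_pos_trans[OF assms(1)] le_neg_trans[OF assms(2)]
    le_pos_trans[OF _ assms(1)] le_neg_trans[OF _ assms(2)]
  unfolding le_pos_Inl by (metis res_oslash res_ominus_l)

lemma ominus_tonic:
  assumes "le_neg A N' N" "le_pos A P P'"
  shows "ominus A N P \<le> ominus A N' P'"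
  using le_pos_refl[of "Inl (ominus A N' P')"] le_neg_trans[OF assms(1)] le_pos_trans[OF assms(2)]
    le_neg_trans[OF _ assms(1)] le_pos_trans[OF _ assms(2)]
  unfolding le_pos_Inl by (metis res_oslash_r res_ominus)

lemma oplus_tonic:
  assumes "le_neg A N N'" "le_neg A M M'"
  shows "oplus A N M \<le> oplus A N' M'"
  using le_neg_refl[of "Inl (oplus A N M)"] le_neg_trans[OF assms(1)] le_neg_trans[OF assms(2)]
    le_neg_trans[OF _ assms(1)] le_neg_trans[OF _ assms(2)]
  unfolding le_neg_Inl by (metis res_oslash_l res_ominus_r)

lemma under_tonic:
  assumes "le_pos A P' P" "le_neg A N N'"
  shows "under A P N \<le> under A P' N'"
  using le_neg_refl[of "Inl (under A P N)"] le_pos_trans[OF assms(1)] le_neg_trans[OF assms(2)]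
    le_pos_trans[OF _ assms(1)] le_neg_trans[OF _ assms(2)]
  unfolding le_neg_Inl by (metis res_under res_over_r)

lemma over_tonic:
  assumes "le_neg A N N'" "le_pos A P' P"
  shows "over A N P \<le> over A N' P'"
  using le_neg_refl[of "Inl (over A N P)"] le_neg_trans[OF assms(1)] le_pos_trans[OF assms(2)]
    le_neg_trans[OF _ assms(1)] le_pos_trans[OF _ assms(2)]
  unfolding le_neg_Inl by (metis res_under_l res_over)

lemma otimes_l_tonic:
  assumes "le_neg A N N'" "le_pos A P P'"
  shows "otimes_l A N P \<le> otimes_l A N' P'"
  using le_neg_refl[of "Inr (otimes_l A N' P')"] le_neg_trans[OF assms(1)] le_pos_trans[OF assms(2)]
    le_neg_trans[OF _ assms(1)] le_pos_trans[OF _ assms(2)]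
  unfolding le_neg_Inr by (metis res_under_l res_over)

lemma oslash_l_tonic:
  assumes "le_neg A N N'" "le_neg A M' M"
  shows "oslash_l A N M \<le> oslash_l A N' M'"
  using le_neg_refl[of "Inr (oslash_l A N' M')"] le_neg_trans[OF assms(1)] le_neg_trans[OF assms(2)]
    le_neg_trans[OF _ assms(1)] le_neg_trans[OF _ assms(2)]
  unfolding le_neg_Inr by (metis res_oslash_l res_ominus_r)

lemma ominus_l_tonic:
  assumes "le_pos A P' P" "le_pos A Q Q'"
  shows "ominus_l A P Q \<le> ominus_l A P' Q'"
  using le_neg_refl[of "Inr (ominus_l A P' Q')"] le_pos_trans[OF assms(1)] le_pos_trans[OF assms(2)]
    le_pos_trans[OF _ assms(1)] le_pos_trans[OF _ assms(2)]
  unfolding le_neg_Inr by (metis res_oslash res_ominus_l)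

lemma oplus_l_tonic:
  assumes "le_pos A P P'" "le_neg A N N'"
  shows "oplus_l A P N \<le> oplus_l A P' N'"
  using le_pos_refl[of "Inr (oplus_l A P N)"] le_pos_trans[OF assms(1)] le_neg_trans[OF assms(2)]
    le_pos_trans[OF _ assms(1)] le_neg_trans[OF _ assms(2)]
  unfolding le_pos_Inr by (metis res_oslash res_ominus_l)

lemma under_l_tonic:
  assumes "le_neg A N' N" "le_neg A M M'"
  shows "under_l A N M \<le> under_l A N' M'"
  using le_pos_refl[of "Inr (under_l A N M)"] le_neg_trans[OF assms(1)] le_neg_trans[OF assms(2)]
    le_neg_trans[OF _ assms(1)] le_neg_trans[OF _ assms(2)]
  unfolding le_pos_Inr by (metis res_under_l res_over)

lemma over_l_tonic:
  assumes "le_pos A P P'" "le_pos A Q' Q"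
  shows "over_l A P Q \<le> over_l A P' Q'"
  using le_pos_refl[of "Inr (over_l A P Q)"] le_pos_trans[OF assms(1)] le_pos_trans[OF assms(2)]
    le_pos_trans[OF _ assms(1)] le_pos_trans[OF _ assms(2)]
  unfolding le_pos_Inr by (metis res_under_r res_over_l)

lemma otimes_r_tonic:
  assumes "le_pos A P P'" "le_neg A N N'"
  shows "otimes_r A P N \<le> otimes_r A P' N'"
  using le_neg_refl[of "Inr (otimes_r A P' N')"] le_pos_trans[OF assms(1)] le_neg_trans[OF assms(2)]
    le_pos_trans[OF _ assms(1)] le_neg_trans[OF _ assms(2)]
  unfolding le_neg_Inr by (metis res_under res_over_r)

lemma oslash_r_tonic:
  assumes "le_pos A P P'" "le_pos A Q' Q"
  shows "oslash_r A P Q \<le> oslash_r A P' Q'"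
  using le_neg_refl[of "Inr (oslash_r A P' Q')"] le_pos_trans[OF assms(1)] le_pos_trans[OF assms(2)]
    le_pos_trans[OF _ assms(1)] le_pos_trans[OF _ assms(2)]
  unfolding le_neg_Inr by (metis res_oslash_r res_ominus)

lemma ominus_r_tonic:
  assumes "le_neg A N' N" "le_neg A M M'"
  shows "ominus_r A N M \<le> ominus_r A N' M'"
  using le_neg_refl[of "Inr (ominus_r A N' M')"] le_neg_trans[OF assms(1)] le_neg_trans[OF assms(2)]
    le_neg_trans[OF _ assms(1)] le_neg_trans[OF _ assms(2)]
  unfolding le_neg_Inr by (metis res_oslash_l res_ominus_r)

lemma oplus_r_tonic:
  assumes "le_neg A N N'" "le_pos A P P'"
  shows "oplus_r A N P \<le> oplus_r A N' P'"
  using le_pos_refl[of "Inr (oplus_r A N P)"] le_neg_trans[OF assms(1)] le_pos_trans[OF assms(2)]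
    le_neg_trans[OF _ assms(1)] le_pos_trans[OF _ assms(2)]
  unfolding le_pos_Inr by (metis res_oslash_r res_ominus)

lemma under_r_tonic:
  assumes "le_pos A P' P" "le_pos A Q Q'"
  shows "under_r A P Q \<le> under_r A P' Q'"
  using le_pos_refl[of "Inr (under_r A P Q)"] le_pos_trans[OF assms(1)] le_pos_trans[OF assms(2)]
    le_pos_trans[OF _ assms(1)] le_pos_trans[OF _ assms(2)]
  unfolding le_pos_Inr by (metis res_under_r res_over_l)

lemma over_r_tonic:
  assumes "le_neg A N N'" "le_neg A M' M"
  shows "over_r A N M \<le> over_r A N' M'"
  using le_pos_refl[of "Inr (over_r A N M)"] le_neg_trans[OF assms(1)] le_neg_trans[OF assms(2)]
    le_neg_trans[OF _ assms(1)] le_neg_trans[OF _ assms(2)]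
  unfolding le_pos_Inr by (metis res_under res_over_r)

end

section \<open>Formulas, structures and sequents\<close>

text \<open>
  Positive and negative atoms are both indexed by \<^typ>\<open>nat\<close>; the two constructors keep them disjoint.
  General formulas and structures are sums, with the same \<^const>\<open>Inl\<close>/\<^const>\<open>Inr\<close> convention as above.
\<close>

datatype pform =
    PAtom nat
  | FOtimes "pform + dpform" "pform + dpform"
  | FOslash "pform + dpform" "nform + dnform"
  | FOminus "nform + dnform" "pform + dpform"
and nform =
    NAtom nat
  | FOplus "nform + dnform" "nform + dnform"
  | FUnder "pform + dpform" "nform + dnform"
  | FOver "nform + dnform" "pform + dpform"
and dpform = FDown nform
and dnform = FUp pform

datatype pstr =
    PForm pform
  | SDdown dnstr
  | SOtimes "pstr + dpstr" "pstr + dpstr"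
  | SOslash "pstr + dpstr" "nstr + dnstr"
  | SOminus "nstr + dnstr" "pstr + dpstr"
and nstr =
    NForm nform
  | SUup dpstr
  | SOplus "nstr + dnstr" "nstr + dnstr"
  | SUnder "pstr + dpstr" "nstr + dnstr"
  | SOver "nstr + dnstr" "pstr + dpstr"
and dpstr =
    DPForm dpform
  | SDown nstr
  | SOplus_l "pstr + dpstr" "nstr + dnstr"
  | SOplus_r "nstr + dnstr" "pstr + dpstr"
  | SUnder_l "nstr + dnstr" "nstr + dnstr"
  | SUnder_r "pstr + dpstr" "pstr + dpstr"
  | SOver_l "pstr + dpstr" "pstr + dpstr"
  | SOver_r "nstr + dnstr" "nstr + dnstr"
and dnstr =
    DNForm dnform
  | SUp pstr
  | SOtimes_l "nstr + dnstr" "pstr + dpstr"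
  | SOtimes_r "pstr + dpstr" "nstr + dnstr"
  | SOslash_l "nstr + dnstr" "nstr + dnstr"
  | SOslash_r "pstr + dpstr" "pstr + dpstr"
  | SOminus_l "pstr + dpstr" "pstr + dpstr"
  | SOminus_r "nstr + dnstr" "nstr + dnstr"

abbreviation GP :: "pform + dpform \<Rightarrow> pstr + dpstr" where
  "GP \<equiv> map_sum PForm DPForm"

abbreviation GN :: "nform + dnform \<Rightarrow> nstr + dnstr" where
  "GN \<equiv> map_sum NForm DNForm"

datatype sequent =
    Seq_pos "pstr + dpstr" "pstr + dpstr"  (infix \<open>\<turnstile>\<^sub>+\<close> 45)
  | Seq_neg "nstr + dnstr" "nstr + dnstr"  (infix \<open>\<turnstile>\<^sub>-\<close> 45)
  | Seq_neut "pstr + dpstr" "nstr + dnstr"  (infix \<open>\<turnstile>\<^sub>0\<close> 45)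

section \<open>The rules of fD.LG\<close>

text \<open>
  Instances of the two-way rules.  A chain of two equivalences contributes two instances, both
  sharing the middle sequent.
\<close>

inductive two_way :: "sequent \<Rightarrow> sequent \<Rightarrow> bool" where
  dp0_under: "two_way (Y \<turnstile>\<^sub>0 Inl (SUnder X D)) (Inl (SOtimes X Y) \<turnstile>\<^sub>0 D)"
| dp0_over: "two_way (Inl (SOtimes X Y) \<turnstile>\<^sub>0 D) (X \<turnstile>\<^sub>0 Inl (SOver D Y))"
| dp0_oslash: "two_way (Inl (SOslash X D) \<turnstile>\<^sub>0 G) (X \<turnstile>\<^sub>0 Inl (SOplus G D))"
| dp0_ominus: "two_way (X \<turnstile>\<^sub>0 Inl (SOplus G D)) (Inl (SOminus G X) \<turnstile>\<^sub>0 D)"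
| dp_under_r: "two_way (Y \<turnstile>\<^sub>+ Inr (SUnder_r X Z)) (Inl (SOtimes X Y) \<turnstile>\<^sub>+ Z)"
| dp_over_l: "two_way (Inl (SOtimes X Y) \<turnstile>\<^sub>+ Z) (X \<turnstile>\<^sub>+ Inr (SOver_l Z Y))"
| dp_oslash_l: "two_way (Inr (SOslash_l S D) \<turnstile>\<^sub>- G) (S \<turnstile>\<^sub>- Inl (SOplus G D))"
| dp_ominus_r: "two_way (S \<turnstile>\<^sub>- Inl (SOplus G D)) (Inr (SOminus_r G S) \<turnstile>\<^sub>- D)"
| dp_ominus: "two_way (Inl (SOminus G X) \<turnstile>\<^sub>+ Y) (X \<turnstile>\<^sub>+ Inr (SOplus_r G Y))"
| dp_oslash_r: "two_way (X \<turnstile>\<^sub>+ Inr (SOplus_r G Y)) (Inr (SOslash_r X Y) \<turnstile>\<^sub>- G)"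
| dp_oslash: "two_way (Inl (SOslash X D) \<turnstile>\<^sub>+ Y) (X \<turnstile>\<^sub>+ Inr (SOplus_l Y D))"
| dp_ominus_l: "two_way (X \<turnstile>\<^sub>+ Inr (SOplus_l Y D)) (Inr (SOminus_l Y X) \<turnstile>\<^sub>- D)"
| dp_under: "two_way (G \<turnstile>\<^sub>- Inl (SUnder X D)) (Inr (SOtimes_r X G) \<turnstile>\<^sub>- D)"
| dp_over_r: "two_way (Inr (SOtimes_r X G) \<turnstile>\<^sub>- D) (X \<turnstile>\<^sub>+ Inr (SOver_r D G))"
| dp_under_l: "two_way (Y \<turnstile>\<^sub>+ Inr (SUnder_l G D)) (Inr (SOtimes_l G Y) \<turnstile>\<^sub>- D)"
| dp_over: "two_way (Inr (SOtimes_l G Y) \<turnstile>\<^sub>- D) (G \<turnstile>\<^sub>- Inl (SOver D Y))"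
| dp_up_ddown: "two_way (Inr (SUp x) \<turnstile>\<^sub>- Inr dd) (Inl x \<turnstile>\<^sub>+ Inl (SDdown dd))"
| dp_up_down: "two_way (Inr (SUp x) \<turnstile>\<^sub>- Inl d) (Inl x \<turnstile>\<^sub>+ Inr (SDown d))"
| dp_down_uup: "two_way (Inr dx \<turnstile>\<^sub>+ Inr (SDown d)) (Inl (SUup dx) \<turnstile>\<^sub>- Inl d)"
| str_down: "two_way (X \<turnstile>\<^sub>0 Inl d) (X \<turnstile>\<^sub>+ Inr (SDown d))"
| str_up: "two_way (Inl x \<turnstile>\<^sub>0 D) (Inr (SUp x) \<turnstile>\<^sub>- D)"

inductive fDLG_rule :: "sequent list \<Rightarrow> sequent \<Rightarrow> bool" where
  ax_pos: "fDLG_rule [] (Inl (PForm (PAtom i)) \<turnstile>\<^sub>+ Inl (PForm (PAtom i)))"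
| ax_neg: "fDLG_rule [] (Inl (NForm (NAtom i)) \<turnstile>\<^sub>- Inl (NForm (NAtom i)))"
| cut_pos: "fDLG_rule [X \<turnstile>\<^sub>+ GP P, GP P \<turnstile>\<^sub>+ Y] (X \<turnstile>\<^sub>+ Y)"
| cut_neg: "fDLG_rule [G \<turnstile>\<^sub>- GN N, GN N \<turnstile>\<^sub>- D] (G \<turnstile>\<^sub>- D)"
| cut_pos0: "fDLG_rule [X \<turnstile>\<^sub>+ GP P, GP P \<turnstile>\<^sub>0 D] (X \<turnstile>\<^sub>0 D)"
| cut_neg0: "fDLG_rule [X \<turnstile>\<^sub>0 GN N, GN N \<turnstile>\<^sub>- D] (X \<turnstile>\<^sub>0 D)"
| tr_otimes: "fDLG_rule [Inl (SOtimes (GP P) (GP Q)) \<turnstile>\<^sub>0 D] (Inl (PForm (FOtimes P Q)) \<turnstile>\<^sub>0 D)"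
| tr_oslash: "fDLG_rule [Inl (SOslash (GP P) (GN N)) \<turnstile>\<^sub>0 D] (Inl (PForm (FOslash P N)) \<turnstile>\<^sub>0 D)"
| tr_ominus: "fDLG_rule [Inl (SOminus (GN N) (GP P)) \<turnstile>\<^sub>0 D] (Inl (PForm (FOminus N P)) \<turnstile>\<^sub>0 D)"
| tr_oplus: "fDLG_rule [X \<turnstile>\<^sub>0 Inl (SOplus (GN N) (GN M))] (X \<turnstile>\<^sub>0 Inl (NForm (FOplus N M)))"
| tr_under: "fDLG_rule [X \<turnstile>\<^sub>0 Inl (SUnder (GP P) (GN N))] (X \<turnstile>\<^sub>0 Inl (NForm (FUnder P N)))"
| tr_over: "fDLG_rule [X \<turnstile>\<^sub>0 Inl (SOver (GN N) (GP P))] (X \<turnstile>\<^sub>0 Inl (NForm (FOver N P)))"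
| tr_down: "fDLG_rule [X \<turnstile>\<^sub>+ Inr (SDown (NForm n))] (X \<turnstile>\<^sub>+ Inr (DPForm (FDown n)))"
| tr_up: "fDLG_rule [Inr (SUp (PForm p)) \<turnstile>\<^sub>- D] (Inr (DNForm (FUp p)) \<turnstile>\<^sub>- D)"
| ton_otimes: "fDLG_rule [X \<turnstile>\<^sub>+ GP P, Y \<turnstile>\<^sub>+ GP Q] (Inl (SOtimes X Y) \<turnstile>\<^sub>+ Inl (PForm (FOtimes P Q)))"
| ton_oplus: "fDLG_rule [GN N \<turnstile>\<^sub>- G, GN M \<turnstile>\<^sub>- D] (Inl (NForm (FOplus N M)) \<turnstile>\<^sub>- Inl (SOplus G D))"
| ton_oslash: "fDLG_rule [X \<turnstile>\<^sub>+ GP P, GN N \<turnstile>\<^sub>- D] (Inl (SOslash X D) \<turnstile>\<^sub>+ Inl (PForm (FOslash P N)))"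
| ton_ominus: "fDLG_rule [X \<turnstile>\<^sub>+ GP P, GN N \<turnstile>\<^sub>- D] (Inl (SOminus D X) \<turnstile>\<^sub>+ Inl (PForm (FOminus N P)))"
| ton_under: "fDLG_rule [X \<turnstile>\<^sub>+ GP P, GN N \<turnstile>\<^sub>- D] (Inl (NForm (FUnder P N)) \<turnstile>\<^sub>- Inl (SUnder X D))"
| ton_over: "fDLG_rule [X \<turnstile>\<^sub>+ GP P, GN N \<turnstile>\<^sub>- D] (Inl (NForm (FOver N P)) \<turnstile>\<^sub>- Inl (SOver D X))"
| ton_down: "fDLG_rule [Inl (NForm n) \<turnstile>\<^sub>- Inl d] (Inr (DPForm (FDown n)) \<turnstile>\<^sub>+ Inr (SDown d))"
| ton_up: "fDLG_rule [Inl x \<turnstile>\<^sub>+ Inl (PForm p)] (Inr (SUp x) \<turnstile>\<^sub>- Inr (DNForm (FUp p)))"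
| two_way_fwd: "two_way s t \<Longrightarrow> fDLG_rule [s] t"
| two_way_bwd: "two_way s t \<Longrightarrow> fDLG_rule [t] s"

section \<open>Interpretation\<close>

text \<open>
  An interpretation is a pair of atom assignments \<open>v\<close> and \<open>w\<close>, extended homomorphically.
\<close>

primrec
    int_pf :: "('p, 'dp, 'n, 'dn) LG_ops \<Rightarrow> (nat \<Rightarrow> 'p) \<Rightarrow> (nat \<Rightarrow> 'n) \<Rightarrow> pform \<Rightarrow> 'p"
and int_nf :: "('p, 'dp, 'n, 'dn) LG_ops \<Rightarrow> (nat \<Rightarrow> 'p) \<Rightarrow> (nat \<Rightarrow> 'n) \<Rightarrow> nform \<Rightarrow> 'n"
and int_dpf :: "('p, 'dp, 'n, 'dn) LG_ops \<Rightarrow> (nat \<Rightarrow> 'p) \<Rightarrow> (nat \<Rightarrow> 'n) \<Rightarrow> dpform \<Rightarrow> 'dp"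
and int_dnf :: "('p, 'dp, 'n, 'dn) LG_ops \<Rightarrow> (nat \<Rightarrow> 'p) \<Rightarrow> (nat \<Rightarrow> 'n) \<Rightarrow> dnform \<Rightarrow> 'dn"
where
  "int_pf A v w (PAtom i) = v i"
| "int_pf A v w (FOtimes P Q) =
     otimes A (map_sum (int_pf A v w) (int_dpf A v w) P) (map_sum (int_pf A v w) (int_dpf A v w) Q)"
| "int_pf A v w (FOslash P N) =
     oslash A (map_sum (int_pf A v w) (int_dpf A v w) P) (map_sum (int_nf A v w) (int_dnf A v w) N)"
| "int_pf A v w (FOminus N P) =
     ominus A (map_sum (int_nf A v w) (int_dnf A v w) N) (map_sum (int_pf A v w) (int_dpf A v w) P)"
| "int_nf A v w (NAtom i) = w i"
| "int_nf A v w (FOplus N M) =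
     oplus A (map_sum (int_nf A v w) (int_dnf A v w) N) (map_sum (int_nf A v w) (int_dnf A v w) M)"
| "int_nf A v w (FUnder P N) =
     under A (map_sum (int_pf A v w) (int_dpf A v w) P) (map_sum (int_nf A v w) (int_dnf A v w) N)"
| "int_nf A v w (FOver N P) =
     over A (map_sum (int_nf A v w) (int_dnf A v w) N) (map_sum (int_pf A v w) (int_dpf A v w) P)"
| "int_dpf A v w (FDown n) = down A (int_nf A v w n)"
| "int_dnf A v w (FUp p) = up A (int_pf A v w p)"

primrec
    int_ps :: "('p, 'dp, 'n, 'dn) LG_ops \<Rightarrow> (nat \<Rightarrow> 'p) \<Rightarrow> (nat \<Rightarrow> 'n) \<Rightarrow> pstr \<Rightarrow> 'p"
and int_ns :: "('p, 'dp, 'n, 'dn) LG_ops \<Rightarrow> (nat \<Rightarrow> 'p) \<Rightarrow> (nat \<Rightarrow> 'n) \<Rightarrow> nstr \<Rightarrow> 'n"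
and int_dps :: "('p, 'dp, 'n, 'dn) LG_ops \<Rightarrow> (nat \<Rightarrow> 'p) \<Rightarrow> (nat \<Rightarrow> 'n) \<Rightarrow> dpstr \<Rightarrow> 'dp"
and int_dns :: "('p, 'dp, 'n, 'dn) LG_ops \<Rightarrow> (nat \<Rightarrow> 'p) \<Rightarrow> (nat \<Rightarrow> 'n) \<Rightarrow> dnstr \<Rightarrow> 'dn"
where
  "int_ps A v w (PForm p) = int_pf A v w p"
| "int_ps A v w (SDdown d) = ddown A (int_dns A v w d)"
| "int_ps A v w (SOtimes X Y) =
     otimes A (map_sum (int_ps A v w) (int_dps A v w) X) (map_sum (int_ps A v w) (int_dps A v w) Y)"
| "int_ps A v w (SOslash X D) =
     oslash A (map_sum (int_ps A v w) (int_dps A v w) X) (map_sum (int_ns A v w) (int_dns A v w) D)"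
| "int_ps A v w (SOminus D X) =
     ominus A (map_sum (int_ns A v w) (int_dns A v w) D) (map_sum (int_ps A v w) (int_dps A v w) X)"
| "int_ns A v w (NForm n) = int_nf A v w n"
| "int_ns A v w (SUup x) = uup A (int_dps A v w x)"
| "int_ns A v w (SOplus G D) =
     oplus A (map_sum (int_ns A v w) (int_dns A v w) G) (map_sum (int_ns A v w) (int_dns A v w) D)"
| "int_ns A v w (SUnder X D) =
     under A (map_sum (int_ps A v w) (int_dps A v w) X) (map_sum (int_ns A v w) (int_dns A v w) D)"
| "int_ns A v w (SOver D X) =
     over A (map_sum (int_ns A v w) (int_dns A v w) D) (map_sum (int_ps A v w) (int_dps A v w) X)"
| "int_dps A v w (DPForm p) = int_dpf A v w p"
| "int_dps A v w (SDown d) = down A (int_ns A v w d)"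
| "int_dps A v w (SOplus_l X D) =
     oplus_l A (map_sum (int_ps A v w) (int_dps A v w) X) (map_sum (int_ns A v w) (int_dns A v w) D)"
| "int_dps A v w (SOplus_r D X) =
     oplus_r A (map_sum (int_ns A v w) (int_dns A v w) D) (map_sum (int_ps A v w) (int_dps A v w) X)"
| "int_dps A v w (SUnder_l G D) =
     under_l A (map_sum (int_ns A v w) (int_dns A v w) G) (map_sum (int_ns A v w) (int_dns A v w) D)"
| "int_dps A v w (SUnder_r X Y) =
     under_r A (map_sum (int_ps A v w) (int_dps A v w) X) (map_sum (int_ps A v w) (int_dps A v w) Y)"
| "int_dps A v w (SOver_l X Y) =
     over_l A (map_sum (int_ps A v w) (int_dps A v w) X) (map_sum (int_ps A v w) (int_dps A v w) Y)"
| "int_dps A v w (SOver_r G D) =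
     over_r A (map_sum (int_ns A v w) (int_dns A v w) G) (map_sum (int_ns A v w) (int_dns A v w) D)"
| "int_dns A v w (DNForm n) = int_dnf A v w n"
| "int_dns A v w (SUp x) = up A (int_ps A v w x)"
| "int_dns A v w (SOtimes_l D X) =
     otimes_l A (map_sum (int_ns A v w) (int_dns A v w) D) (map_sum (int_ps A v w) (int_dps A v w) X)"
| "int_dns A v w (SOtimes_r X D) =
     otimes_r A (map_sum (int_ps A v w) (int_dps A v w) X) (map_sum (int_ns A v w) (int_dns A v w) D)"
| "int_dns A v w (SOslash_l G D) =
     oslash_l A (map_sum (int_ns A v w) (int_dns A v w) G) (map_sum (int_ns A v w) (int_dns A v w) D)"
| "int_dns A v w (SOslash_r X Y) =
     oslash_r A (map_sum (int_ps A v w) (int_dps A v w) X) (map_sum (int_ps A v w) (int_dps A v w) Y)"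
| "int_dns A v w (SOminus_l X Y) =
     ominus_l A (map_sum (int_ps A v w) (int_dps A v w) X) (map_sum (int_ps A v w) (int_dps A v w) Y)"
| "int_dns A v w (SOminus_r G D) =
     ominus_r A (map_sum (int_ns A v w) (int_dns A v w) G) (map_sum (int_ns A v w) (int_dns A v w) D)"

abbreviation int_gp :: "('p, 'dp, 'n, 'dn) LG_ops \<Rightarrow> (nat \<Rightarrow> 'p) \<Rightarrow> (nat \<Rightarrow> 'n) \<Rightarrow> pstr + dpstr \<Rightarrow> 'p + 'dp" where
  "int_gp A v w \<equiv> map_sum (int_ps A v w) (int_dps A v w)"

abbreviation int_gn :: "('p, 'dp, 'n, 'dn) LG_ops \<Rightarrow> (nat \<Rightarrow> 'p) \<Rightarrow> (nat \<Rightarrow> 'n) \<Rightarrow> nstr + dnstr \<Rightarrow> 'n + 'dn" where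
  "int_gn A v w \<equiv> map_sum (int_ns A v w) (int_dns A v w)"

primrec holds :: "('p::order, 'dp::order, 'n::order, 'dn::order) LG_ops \<Rightarrow>
    (nat \<Rightarrow> 'p) \<Rightarrow> (nat \<Rightarrow> 'n) \<Rightarrow> sequent \<Rightarrow> bool" where
  "holds A v w (X \<turnstile>\<^sub>+ Y) \<longleftrightarrow> le_pos A (int_gp A v w X) (int_gp A v w Y)"
| "holds A v w (G \<turnstile>\<^sub>- D) \<longleftrightarrow> le_neg A (int_gn A v w G) (int_gn A v w D)"
| "holds A v w (X \<turnstile>\<^sub>0 D) \<longleftrightarrow> prec0 A (int_gp A v w X) (int_gn A v w D)"

end

theory Submission
  imports Defs
begin

text \<open>
  Display postulates are residuation laws or adjunctions, translation rules do not change the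
  interpretation of a sequent, and tonicity rules express the tonicity of the operations.  What
  remains are the structural rules and the neutral cuts.  A pair related by \<open>prec0\<close> has at least one
  pure component: if the right one is pure, the relation reads as \<open>le_pos\<close> against a \<open>down\<close>, and if
  the left one is, as \<open>le_neg\<close> from an \<open>up\<close>.  This is what the structural rules say; with the
  transitivity of the two orders and the monotonicity of \<open>up\<close> it makes \<open>prec0\<close> closed under weakening
  on both sides, which is what the neutral cuts need.
\<close>

lemma adjunction_iff: "adjunction f g \<Longrightarrow> f a \<le> b \<longleftrightarrow> a \<le> g b"
  by (simp add: adjunction_def)

lemma adjunction_mono_left:
  assumes "adjunction f g"
  shows "mono f"
proof (rule monoI)
  fix a b :: 'a
  assume "a \<le> b"
  also have "b \<le> g (f b)"
    by (simp add: adjunction_iff[OF assms, symmetric])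
  finally show "f a \<le> f b"
    by (simp add: adjunction_iff[OF assms])
qed

lemma adjunction_mono_right:
  assumes "adjunction f g"
  shows "mono g"
proof (rule monoI)
  fix a b :: 'b
  have "f (g a) \<le> a"
    by (simp add: adjunction_iff[OF assms])
  also assume "a \<le> b"
  finally show "g a \<le> g b"
    by (simp add: adjunction_iff[OF assms, symmetric])
qed

lemma int_gp_GP: "int_gp A v w (GP P) = map_sum (int_pf A v w) (int_dpf A v w) P"
  by (cases P) simp_all

lemma int_gn_GN: "int_gn A v w (GN N) = map_sum (int_nf A v w) (int_dnf A v w) N"
  by (cases N) simp_all

context fully_polarized_LG_algebra
begin

lemma up_mono: "a \<le> b \<Longrightarrow> up A a \<le> up A b"
  using adjunction_mono_left[OF adj_up] by (rule monoD)

lemma down_mono: "a \<le> b \<Longrightarrow> down A a \<le> down A b"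
  using adjunction_mono_right[OF adj_uup] by (rule monoD)

lemma prec0_Inl_iff_le_pos_down: "prec0 A P (Inl b) \<longleftrightarrow> le_pos A P (Inr (down A b))"
  by (cases P) (simp_all add: wkp_down adjunction_iff[OF adj_uup])

lemma prec0_Inl_iff_le_neg_up: "prec0 A (Inl a) N \<longleftrightarrow> le_neg A (Inr (up A a)) N"
  by (cases N) (simp_all add: wkm_up)

lemma le_pos_prec0_trans:
  assumes "le_pos A P Q" and "prec0 A Q N"
  shows "prec0 A P N"
proof (cases N)
  case (Inl n)
  with assms show ?thesis
    by (auto simp: prec0_Inl_iff_le_pos_down intro: le_pos_trans)
next
  case (Inr d)
  with assms obtain p q where P: "P = Inl p" and "p \<le> q" "up A q \<le> d"
    by (cases P; cases Q) auto
  have "up A p \<le> up A q"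
    using \<open>p \<le> q\<close> by (rule up_mono)
  also note \<open>up A q \<le> d\<close>
  finally show ?thesis
    using P Inr by simp
qed

lemma prec0_le_neg_trans:
  assumes "prec0 A P M" and "le_neg A M N"
  shows "prec0 A P N"
proof (cases P)
  case (Inl p)
  with assms show ?thesis
    by (auto simp: prec0_Inl_iff_le_neg_up intro: le_neg_trans)
next
  case (Inr d)
  with assms obtain m n where "N = Inl n" "uup A d \<le> m" "m \<le> n"
    by (cases M; cases N) auto
  then show ?thesis
    using Inr by auto
qed

lemmas residuation =
  res0_under res0_over res0_oslash res0_ominus
  res_under_r res_over_l res_oslash_l res_ominus_r
  res_under_l res_over res_oslash_r res_ominus
  res_under res_over_r res_oslash res_ominus_l

lemmas tonicity =
  otimes_tonic oslash_tonic ominus_tonic oplus_tonic under_tonic over_tonic up_mono down_mono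

lemma two_way_sound:
  assumes "two_way s t"
  shows "holds A v w s \<longleftrightarrow> holds A v w t"
  using assms
proof cases
  case dp_up_ddown
  then show ?thesis by (simp add: adjunction_iff[OF adj_up])
next
  case dp_up_down
  then show ?thesis by (simp add: wkm_up wkp_down)
next
  case dp_down_uup
  then show ?thesis by (simp add: adjunction_iff[OF adj_uup])
next
  case str_down
  then show ?thesis by (simp add: prec0_Inl_iff_le_pos_down)
next
  case str_up
  then show ?thesis by (simp add: prec0_Inl_iff_le_neg_up)
qed (simp_all add: residuation)

lemma fDLG_rule_sound:
  assumes "fDLG_rule prems concl" and "\<forall>s\<in>set prems. holds A v w s"
  shows "holds A v w concl"
  using assms
proof cases
  case cut_pos
  with assms(2) show ?thesis by (auto intro: le_pos_trans)
next
  case cut_neg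
  with assms(2) show ?thesis by (auto intro: le_neg_trans)
next
  case cut_pos0
  with assms(2) show ?thesis by (auto intro: le_pos_prec0_trans)
next
  case cut_neg0
  with assms(2) show ?thesis by (auto intro: prec0_le_neg_trans)
next
  case two_way_fwd
  with assms(2) show ?thesis by (simp add: two_way_sound)
next
  case two_way_bwd
  with assms(2) show ?thesis by (simp add: two_way_sound)
qed (use assms(2) in \<open>simp_all add: int_gp_GP int_gn_GN tonicity\<close>)

end

theorem theorem26:
  fixes A :: "('p::order, 'dp::order, 'n::order, 'dn::order) LG_ops"
    and v :: "nat \<Rightarrow> 'p" and w :: "nat \<Rightarrow> 'n"
    and prems :: "sequent list" and concl :: sequent
  assumes "fully_polarized_LG_algebra A"
    and "fDLG_rule prems concl"
    and "\<forall>s\<in>set prems. holds A v w s"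
  shows "holds A v w concl"
proof -
  interpret fully_polarized_LG_algebra A by fact
  show ?thesis
    using assms(2,3) by (rule fDLG_rule_sound)
qed

end
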